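(* Let $d\ge2$, $\beta>-\frac d2$, $0\le m\le n$ be integers and $1\le\ell\le\dim\mathcal H_m^d$. Let $\mathsf C_{m,\ell}^n$ (depending on $\gamma>-\frac12$) be the generalized Gegenbauer polynomials on the double cone and $\mathsf H_{m,\ell}^n$ the generalized Hermite polynomials on the double cone, with squared norms $h_{m,n}^{\mathsf C}$ and $h_{m,n}^{\mathsf H}$. Then, for every $(x,t)$ with $\|x\|=|t|$, $$\lim_{\gamma\to\infty}\frac{\mathsf C_{m,\ell}^n\big(\frac x{\sqrt\gamma},\frac t{\sqrt\gamma}\big)}{\sqrt{h_{m,n}^{\mathsf C}}}=\frac{\mathsf H_{m,\ell}^n(x,t)}{\sqrt{h_{m,n}^{\mathsf H}}}.$$
   Context: $\mathcal H_m^d$ is the space of homogeneous harmonic polynomials of degree $m$ in $d$ variables, and $\{Y_\ell^m\}$ is a basis of it that is orthonormal with respect to the normalized surface measure on $\mathbb S^{d-1}$. Generalized Gegenbauer polynomials: $C_{2k}^{(\lambda,\mu)}(t)=\frac{(\lambda+\mu)_k}{(\mu+\frac12)_k}P_k^{(\lambda-\frac12,\mu-\frac12)}(2t^2-1)$ and $C_{2k+1}^{(\lambda,\mu)}(t)=\frac{(\lambda+\mu)_{k+1}}{(\mu+\frac12)_{k+1}}\,t\,P_k^{(\lambda-\frac12,\mu+\frac12)}(2t^2-1)$, with $P_k^{(a,b)}$ the Jacobi polynomials and $(a)_k$ the Pochhammer symbol. Generalized Hermite polynomials: $H_{2k}^\mu(t)=(-1)^k2^{2k}k!\,L_k^{\mu-\frac12}(t^2)$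 and $H_{2k+1}^\mu(t)=(-1)^k2^{2k+1}k!\,t\,L_k^{\mu+\frac12}(t^2)$, with $L_k^a$ the Laguerre polynomials. Set $$\mathsf C_{m,\ell}^n(x,t)=C_{n-m}^{(\gamma,m+\beta+\frac{d-1}2)}(t)\,Y_\ell^m(x),\qquad \mathsf H_{m,\ell}^n(x,t)=H_{n-m}^{m+\beta+\frac{d-1}2}(t)\,Y_\ell^m(x).$$ The squared norms are $h_{m,n}^{\mathsf C}=\langle\mathsf C_{m,\ell}^n,\mathsf C_{m,\ell}^n\rangle$ with $\langle f,g\rangle=b\int_{-1}^1|t|^{d-1}\int_{\mathbb S^{d-1}}(fg)(|t|\xi,t)\,d\sigma(\xi)\,|t|^{2\beta}(1-t^2)^{\gamma-\frac12}dt$, and $h_{m,n}^{\mathsf H}=\langle\mathsf H_{m,\ell}^n,\mathsf H_{m,\ell}^n\rangle'$ with $\langle f,g\rangle'=b'\int_{-\infty}^\infty|t|^{d-1}\int_{\mathbb S^{d-1}}(fg)(|t|\xi,t)\,d\sigma(\xi)\,|t|^{2\beta}e^{-t^2}dt$. The constants $b,b'$ are such that the constant function $1$ has norm $1$. *)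

theory Defs
  imports "HOL-Probability.Probability" "HOL-Library.Function_Algebras"
begin

text \<open>The Jacobi polynomial \<open>P_k^(a,b)\<close> and the Laguerre polynomial \<open>L_k^a\<close>, in the standard
  normalization \<open>P_k^(a,b)(1) = (k + a choose k)\<close>, \<open>L_k^a(0) = (k + a choose k)\<close>, by the explicit sums
  in Szego's book (4.3.2) and (5.1.6).\<close>

definition jacobi_poly :: "nat \<Rightarrow> real \<Rightarrow> real \<Rightarrow> real \<Rightarrow> real" where
  "jacobi_poly k a b x =
     (\<Sum>s\<le>k. ((real k + a) gchoose (k - s)) * ((real k + b) gchoose s) *
        ((x - 1) / 2) ^ s * ((x + 1) / 2) ^ (k - s))"

definition laguerre_poly :: "nat \<Rightarrow> real \<Rightarrow> real \<Rightarrow> real" where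
  "laguerre_poly k a x =
     (\<Sum>j\<le>k. (- 1) ^ j * ((real k + a) gchoose (k - j)) * x ^ j / fact j)"

definition gen_gegenbauer :: "real \<Rightarrow> real \<Rightarrow> nat \<Rightarrow> real \<Rightarrow> real" where
  "gen_gegenbauer lam mu n t =
     (let k = n div 2 in
      if even n then
        pochhammer (lam + mu) k / pochhammer (mu + 1/2) k *
          jacobi_poly k (lam - 1/2) (mu - 1/2) (2 * t\<^sup>2 - 1)
      else
        pochhammer (lam + mu) (k + 1) / pochhammer (mu + 1/2) (k + 1) *
          t * jacobi_poly k (lam - 1/2) (mu + 1/2) (2 * t\<^sup>2 - 1))"

definition gen_hermite :: "real \<Rightarrow> nat \<Rightarrow> real \<Rightarrow> real" where
  "gen_hermite mu n t =
     (let k = n div 2 in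
      if even n then
        (- 1) ^ k * 2 ^ (2 * k) * fact k * laguerre_poly k (mu - 1/2) (t\<^sup>2)
      else
        (- 1) ^ k * 2 ^ (2 * k + 1) * fact k * t * laguerre_poly k (mu + 1/2) (t\<^sup>2))"

text \<open>The normalized surface measure of the unit sphere: the measure of a subset \<open>A\<close> of the sphere
  is the proportion of the unit ball occupied by the radii ending in \<open>A\<close>. It is kept as a measure
  on the whole space, concentrated on the sphere (the origin, which the radial projection
  sends to itself, is a null set).\<close>

definition sphere_measure :: "(real ^ 'd) measure" where
  "sphere_measure = distr (uniform_measure lborel (ball 0 1)) borel (\<lambda>x. x /\<^sub>R norm x)"

definition homogeneous_poly :: "nat \<Rightarrow> (real ^ 'd \<Rightarrow> real) \<Rightarrow> bool" where
  "homogeneous_poly m f \<longleftrightarrow>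
     (\<exists>c :: ('d \<Rightarrow> nat) \<Rightarrow> real.
        f = (\<lambda>x. \<Sum>\<alpha> | (\<Sum>i\<in>UNIV. \<alpha> i) = m. c \<alpha> * (\<Prod>i\<in>UNIV. (x $ i) ^ \<alpha> i)))"

definition laplacian :: "(real ^ 'd \<Rightarrow> real) \<Rightarrow> real ^ 'd \<Rightarrow> real" where
  "laplacian f x = (\<Sum>i\<in>UNIV. (deriv ^^ 2) (\<lambda>s. f (x + s *\<^sub>R axis i 1)) 0)"

definition harmonic_space :: "nat \<Rightarrow> (real ^ 'd \<Rightarrow> real) set" where
  "harmonic_space m = {f. homogeneous_poly m f \<and> (\<forall>x. laplacian f x = 0)}"

interpretation fun_vs: vector_space "\<lambda>(c::real) (f :: 'a \<Rightarrow> real) x. c * f x"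
  by unfold_locales (auto simp: fun_eq_iff algebra_simps)

text \<open>An orthonormal basis is indexed by \<open>1, \<dots>, dim\<close>; the values of \<open>Y\<close> at other indices are
  irrelevant.\<close>

definition harmonic_onb :: "nat \<Rightarrow> (nat \<Rightarrow> real ^ 'd \<Rightarrow> real) \<Rightarrow> bool" where
  "harmonic_onb m Y \<longleftrightarrow>
     (let I = {1..fun_vs.dim (harmonic_space m :: (real ^ 'd \<Rightarrow> real) set)} in
      inj_on Y I \<and> fun_vs.independent (Y ` I) \<and> fun_vs.span (Y ` I) = harmonic_space m \<and>
      (\<forall>i\<in>I. \<forall>j\<in>I. (LINT \<xi>|sphere_measure. Y i \<xi> * Y j \<xi>) = (if i = j then 1 else 0)))"

text \<open>A point \<open>(x, t)\<close> of the double cone is a point with \<open>norm x = \<bar>t\<bar>\<close>. The first two functions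
  omit the constants \<open>b\<close> and \<open>b'\<close>; the next two put them in, as the reciprocal of the value at
  \<open>f = g = 1\<close>.\<close>

definition cone_form_C ::
  "real \<Rightarrow> real \<Rightarrow> ((real ^ 'd) \<times> real \<Rightarrow> real) \<Rightarrow> ((real ^ 'd) \<times> real \<Rightarrow> real) \<Rightarrow> real" where
  "cone_form_C \<beta> \<gamma> f g =
     (LBINT t:{-1..1}. \<bar>t\<bar> ^ (CARD('d) - 1) *
        (LINT \<xi>|sphere_measure. f (\<bar>t\<bar> *\<^sub>R \<xi>, t) * g (\<bar>t\<bar> *\<^sub>R \<xi>, t)) *
        \<bar>t\<bar> powr (2 * \<beta>) * (1 - t\<^sup>2) powr (\<gamma> - 1/2))"

definition cone_form_H ::
  "real \<Rightarrow> ((real ^ 'd) \<times> real \<Rightarrow> real) \<Rightarrow> ((real ^ 'd) \<times> real \<Rightarrow> real) \<Rightarrow> real" where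
  "cone_form_H \<beta> f g =
     (LBINT t. \<bar>t\<bar> ^ (CARD('d) - 1) *
        (LINT \<xi>|sphere_measure. f (\<bar>t\<bar> *\<^sub>R \<xi>, t) * g (\<bar>t\<bar> *\<^sub>R \<xi>, t)) *
        \<bar>t\<bar> powr (2 * \<beta>) * exp (- t\<^sup>2))"

definition cone_inner_C ::
  "real \<Rightarrow> real \<Rightarrow> ((real ^ 'd) \<times> real \<Rightarrow> real) \<Rightarrow> ((real ^ 'd) \<times> real \<Rightarrow> real) \<Rightarrow> real" where
  "cone_inner_C \<beta> \<gamma> f g =
     1 / cone_form_C \<beta> \<gamma> (\<lambda>_ :: (real ^ 'd) \<times> real. 1) (\<lambda>_. 1) * cone_form_C \<beta> \<gamma> f g"

definition cone_inner_H ::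
  "real \<Rightarrow> ((real ^ 'd) \<times> real \<Rightarrow> real) \<Rightarrow> ((real ^ 'd) \<times> real \<Rightarrow> real) \<Rightarrow> real" where
  "cone_inner_H \<beta> f g =
     1 / cone_form_H \<beta> (\<lambda>_ :: (real ^ 'd) \<times> real. 1) (\<lambda>_. 1) * cone_form_H \<beta> f g"

definition cone_C ::
  "(nat \<Rightarrow> nat \<Rightarrow> real ^ 'd \<Rightarrow> real) \<Rightarrow> real \<Rightarrow> real \<Rightarrow> nat \<Rightarrow> nat \<Rightarrow> nat \<Rightarrow> (real ^ 'd) \<times> real \<Rightarrow> real" where
  "cone_C Y \<beta> \<gamma> m l n = (\<lambda>(x, t).
     gen_gegenbauer \<gamma> (real m + \<beta> + (real CARD('d) - 1) / 2) (n - m) t * Y m l x)"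

definition cone_H ::
  "(nat \<Rightarrow> nat \<Rightarrow> real ^ 'd \<Rightarrow> real) \<Rightarrow> real \<Rightarrow> nat \<Rightarrow> nat \<Rightarrow> nat \<Rightarrow> (real ^ 'd) \<times> real \<Rightarrow> real" where
  "cone_H Y \<beta> m l n = (\<lambda>(x, t).
     gen_hermite (real m + \<beta> + (real CARD('d) - 1) / 2) (n - m) t * Y m l x)"

definition norm_sq_C ::
  "(nat \<Rightarrow> nat \<Rightarrow> real ^ 'd \<Rightarrow> real) \<Rightarrow> real \<Rightarrow> real \<Rightarrow> nat \<Rightarrow> nat \<Rightarrow> nat \<Rightarrow> real" where
  "norm_sq_C Y \<beta> \<gamma> m l n = cone_inner_C \<beta> \<gamma> (cone_C Y \<beta> \<gamma> m l n) (cone_C Y \<beta> \<gamma> m l n)"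

definition norm_sq_H ::
  "(nat \<Rightarrow> nat \<Rightarrow> real ^ 'd \<Rightarrow> real) \<Rightarrow> real \<Rightarrow> nat \<Rightarrow> nat \<Rightarrow> nat \<Rightarrow> real" where
  "norm_sq_H Y \<beta> m l n = cone_inner_H \<beta> (cone_H Y \<beta> m l n) (cone_H Y \<beta> m l n)"

end

theory Submission
  imports Defs "HOL-Real_Asymp.Real_Asymp"
begin

text \<open>
  Integrating over the sphere turns the norms into one-dimensional integrals with weight
  \<open>\<bar>t\<bar>\<^sup>a (1 - t\<^sup>2) powr (\<gamma> - 1/2)\<close>. Substituting \<open>t = u / sqrt \<gamma>\<close>, the powers of \<open>sqrt \<gamma>\<close> cancel
  between the polynomial and the square root of its norm, the weight tends to \<open>\<bar>u\<bar>\<^sup>a exp (- u\<^sup>2)\<close>, and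
  the rescaled Gegenbauer polynomial tends to a positive multiple of the Hermite polynomial, so that
  no closed form of the norms is needed. Dominated convergence applies because for \<open>\<bar>u\<bar> \<le> sqrt \<gamma>\<close>
  the factor \<open>u\<^sup>2 / \<gamma> - 1\<close> in the sum for the Jacobi polynomial has modulus at most \<open>1\<close>: the rescaled
  polynomials are bounded by \<open>K exp \<bar>u\<bar>\<close> and the weight by \<open>\<bar>u\<bar>\<^sup>a exp (- u\<^sup>2 / 2)\<close>, uniformly in \<open>\<gamma>\<close>.
\<close>

section \<open>Majorants and dominated convergence for the rescaled weight\<close>

lemma integrable_abs_powr_exp_neg:
  fixes a :: real
  assumes "a > -1"
  shows "integrable lborel (\<lambda>u. \<bar>u\<bar> powr a * exp (- \<bar>u\<bar>))"
proof -
  \<comment> \<open>This is the integral for Gamma at \<open>a + 1 > 0\<close>. Nonnegativity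
    upgrades gauge integrability to Lebesgue integrability, and reflection gives the negative
    half-line.\<close>
  have "(\<lambda>t. t powr (a + 1 - 1) / exp t) integrable_on {0..}"
    using Gamma_integral_real[of "a + 1"] assms by (auto simp: integrable_on_def)
  then have "(\<lambda>t. t powr a / exp t) absolutely_integrable_on {0..}"
    by (intro nonnegative_absolutely_integrable_1) auto
  then have "integrable lebesgue (\<lambda>t. indicator {0..} t * (t powr a / exp t))"
    by (simp add: set_integrable_def)
  then have pos: "integrable lborel (\<lambda>t. indicator {0..} t * (t powr a / exp t))"
    by (subst (asm) integrable_completion) auto
  then have neg: "integrable lborel (\<lambda>t. indicator {0..} (- t) * ((- t) powr a / exp (- t)))"
    using lborel_integrable_real_affine[OF pos, of "-1" 0] by simp
  show ?thesis
    by (rule Bochner_Integration.integrable_bound[OF Bochner_Integration.integrable_add[OF pos neg]])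
       (auto simp: indicator_def exp_minus field_simps)
qed

text \<open>Up to a constant this is the majorant used for dominated convergence:
  \<open>exp (2 * \<bar>u\<bar>)\<close> comes from squaring a bound
  \<open>K * exp \<bar>u\<bar>\<close>, and \<open>exp (- u\<^sup>2 / 2)\<close> from the estimate
  of the weight.\<close>

lemma integrable_abs_powr_gaussian:
  fixes a :: real
  assumes "a > -1"
  shows "integrable lborel (\<lambda>u. \<bar>u\<bar> powr a * (exp (2 * \<bar>u\<bar>) * exp (- u\<^sup>2 / 2)))"
proof (rule Bochner_Integration.integrable_bound)
  show "integrable lborel (\<lambda>u. exp (9/2) * (\<bar>u\<bar> powr a * exp (- \<bar>u\<bar>)))"
    using integrable_abs_powr_exp_neg[OF assms] by simp
  have "exp (2 * \<bar>u\<bar>) * exp (- u\<^sup>2 / 2) \<le> exp (9/2) * exp (- \<bar>u\<bar>)" for u :: real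
  proof -
    \<comment> \<open>Completing the square: the wanted exponent inequality amounts to
      \<open>3 * \<bar>u\<bar> - u\<^sup>2 / 2 \<le> 9/2\<close>.\<close>
    have "0 \<le> (\<bar>u\<bar> - 3)\<^sup>2" by simp
    then have "2 * \<bar>u\<bar> + - u\<^sup>2 / 2 \<le> 9/2 + - \<bar>u\<bar>"
      by (simp add: power2_eq_square algebra_simps)
    then show ?thesis by (simp flip: exp_add)
  qed
  then have "\<bar>u\<bar> powr a * (exp (2 * \<bar>u\<bar>) * exp (- u\<^sup>2 / 2)) \<le> \<bar>u\<bar> powr a * (exp (9/2) * exp (- \<bar>u\<bar>))" for u :: real
    by (intro mult_left_mono) auto
  then show "AE u in lborel. norm (\<bar>u\<bar> powr a * (exp (2 * \<bar>u\<bar>) * exp (- u\<^sup>2 / 2)))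
      \<le> norm (exp (9/2) * (\<bar>u\<bar> powr a * exp (- \<bar>u\<bar>)))"
    by (simp add: mult_ac)
qed simp

text \<open>Raise \<open>1 - y \<le> exp (- y)\<close> with \<open>y = u\<^sup>2 / g\<close> to the
  power \<open>g - 1/2\<close>; the base is nonnegative since
  \<open>\<bar>u\<bar> \<le> sqrt g\<close>. For \<open>g \<ge> 1\<close> the ratio
  \<open>(g - 1/2) / g\<close> is at least \<open>1/2\<close>, whence the halved exponent.\<close>

lemma one_minus_powr_le_gaussian:
  fixes g u :: real
  assumes "g \<ge> 1" and "\<bar>u\<bar> \<le> sqrt g"
  shows "(1 - u\<^sup>2 / g) powr (g - 1/2) \<le> exp (- u\<^sup>2 / 2)"
proof -
  have u: "u\<^sup>2 \<le> g"
    using assms by (metis abs_ge_zero power2_abs real_le_lsqrt real_sqrt_le_iff real_sqrt_abs)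
  have "(1 - u\<^sup>2 / g) powr (g - 1/2) \<le> exp (- (u\<^sup>2 / g)) powr (g - 1/2)"
    using assms u exp_ge_add_one_self[of "- (u\<^sup>2 / g)"] by (intro powr_mono2) (auto simp: field_simps)
  also have "\<dots> = exp (- (u\<^sup>2 / g) * (g - 1/2))"
    by (simp add: powr_def)
  also have "\<dots> \<le> exp (- u\<^sup>2 / 2)"
  proof -
    have "u\<^sup>2 \<le> u\<^sup>2 * g"
      using assms by (simp add: mult_le_cancel_left1)
    then show ?thesis
      using assms by (simp add: field_simps)
  qed
  finally show ?thesis .
qed

lemma one_minus_powr_tendsto_gaussian:
  fixes u :: real
  shows "((\<lambda>g. (1 - u\<^sup>2 / g) powr (g - 1/2)) \<longlongrightarrow> exp (- u\<^sup>2)) at_top"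
proof -
  have "((\<lambda>g. (1 - u\<^sup>2 / g) powr g) \<longlongrightarrow> exp (- u\<^sup>2)) at_top"
    using tendsto_exp_limit_at_top[of "- u\<^sup>2"] by simp
  moreover have "((\<lambda>g. (1 - u\<^sup>2 / g) powr (1/2)) \<longlongrightarrow> 1 powr (1/2)) at_top"
    by (intro tendsto_powr) (real_asymp | simp)+
  ultimately have "((\<lambda>g. (1 - u\<^sup>2 / g) powr g / (1 - u\<^sup>2 / g) powr (1/2)) \<longlongrightarrow> exp (- u\<^sup>2) / 1 powr (1/2)) at_top"
    by (intro tendsto_divide) auto
  then show ?thesis
    by (simp add: powr_diff)
qed

text \<open>The majorant is demanded only on the interval selected by the indicator, where the
  rescaled variable lives. The same domination makes the limit function integrable, which later
  allows its integral to be shown positive.\<close>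

lemma powr_weight_integral_tendsto:
  fixes F :: "real \<Rightarrow> real \<Rightarrow> real"
  assumes a: "a > -1"
    and meas: "\<And>g. F g \<in> borel_measurable borel"
    and lim: "\<And>u. ((\<lambda>g. F g u) \<longlongrightarrow> H u) at_top"
    and bound: "eventually (\<lambda>g. \<forall>u. \<bar>u\<bar> \<le> sqrt g \<longrightarrow> \<bar>F g u\<bar> \<le> K * exp \<bar>u\<bar>) at_top"
  shows "((\<lambda>g. LINT u|lborel. indicator {- sqrt g..sqrt g} u *
             ((F g u)\<^sup>2 * \<bar>u\<bar> powr a * (1 - u\<^sup>2 / g) powr (g - 1/2)))
          \<longlongrightarrow> (LINT u|lborel. (H u)\<^sup>2 * \<bar>u\<bar> powr a * exp (- u\<^sup>2))) at_top"
    (is ?lim)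
  and "integrable lborel (\<lambda>u. (H u)\<^sup>2 * \<bar>u\<bar> powr a * exp (- u\<^sup>2))" (is ?int)
proof -
  let ?s = "\<lambda>g u. indicator {- sqrt g..sqrt g} u *
             ((F g u)\<^sup>2 * \<bar>u\<bar> powr a * (1 - u\<^sup>2 / g) powr (g - 1/2))"
  let ?f = "\<lambda>u. (H u)\<^sup>2 * \<bar>u\<bar> powr a * exp (- u\<^sup>2)"
  let ?w = "\<lambda>u. K\<^sup>2 * (\<bar>u\<bar> powr a * (exp (2 * \<bar>u\<bar>) * exp (- u\<^sup>2 / 2)))"
  \<comment> \<open>Measurability passes to pointwise limits of sequences, so the limit is taken
    along the natural numbers.\<close>
  have [measurable]: "H \<in> borel_measurable borel"
  proof (rule borel_measurable_LIMSEQ_real)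
    show "F (real i) \<in> borel_measurable borel" for i by (rule meas)
    show "(\<lambda>i. F (real i) u) \<longlonglongrightarrow> H u" for u
      using filterlim_compose[OF lim filterlim_real_sequentially] .
  qed
  note [measurable] = meas
  have w: "integrable lborel ?w"
    using integrable_abs_powr_gaussian[OF a] by simp
  have b: "eventually (\<lambda>g. AE u in lborel. norm (?s g u) \<le> ?w u) at_top"
    using bound eventually_ge_at_top[of 1]
  proof eventually_elim
    case (elim g)
    have "norm (?s g u) \<le> ?w u" for u
    proof (cases "\<bar>u\<bar> \<le> sqrt g")
      case True
      then have "(F g u)\<^sup>2 \<le> (K * exp \<bar>u\<bar>)\<^sup>2"
        using elim by (metis abs_ge_zero power2_abs power_mono)
      also have "\<dots> = K\<^sup>2 * exp (2 * \<bar>u\<bar>)"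
        by (simp add: power_mult_distrib exp_double)
      finally have "(F g u)\<^sup>2 * (1 - u\<^sup>2 / g) powr (g - 1/2) \<le> K\<^sup>2 * exp (2 * \<bar>u\<bar>) * exp (- u\<^sup>2 / 2)"
        using one_minus_powr_le_gaussian[OF elim(2) True] by (intro mult_mono) auto
      then have "\<bar>u\<bar> powr a * ((F g u)\<^sup>2 * (1 - u\<^sup>2 / g) powr (g - 1/2))
          \<le> \<bar>u\<bar> powr a * (K\<^sup>2 * exp (2 * \<bar>u\<bar>) * exp (- u\<^sup>2 / 2))"
        by (intro mult_left_mono) auto
      then show ?thesis
        by (simp add: indicator_def abs_mult mult_ac)
    qed (auto simp: indicator_def)
    then show ?case by simp
  qed
  have l: "AE u in lborel. ((\<lambda>g. ?s g u) \<longlongrightarrow> ?f u) at_top"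
  proof (rule AE_I2)
    fix u :: real
    have "((\<lambda>g. (F g u)\<^sup>2 * \<bar>u\<bar> powr a * (1 - u\<^sup>2 / g) powr (g - 1/2)) \<longlongrightarrow> ?f u) at_top"
      by (intro tendsto_intros lim one_minus_powr_tendsto_gaussian)
    \<comment> \<open>For fixed \<open>u\<close> the growing interval contains \<open>u\<close> as
      soon as \<open>g \<ge> u\<^sup>2\<close>, so the indicator does not affect the limit.\<close>
    moreover have "eventually (\<lambda>g. (F g u)\<^sup>2 * \<bar>u\<bar> powr a * (1 - u\<^sup>2 / g) powr (g - 1/2) = ?s g u) at_top"
      using eventually_ge_at_top[of "u\<^sup>2"]
    proof eventually_elim
      case (elim g)
      then have "\<bar>u\<bar> \<le> sqrt g"
        by (metis real_sqrt_abs real_sqrt_le_iff)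
      then show ?case
        by (auto simp: indicator_def)
    qed
    ultimately show "((\<lambda>g. ?s g u) \<longlongrightarrow> ?f u) at_top"
      by (rule Lim_transform_eventually)
  qed
  show ?lim
    by (rule integral_dominated_convergence_at_top[OF _ _ w l b]) measurable
  show ?int
    by (rule integrable_dominated_convergence_at_top[OF _ _ w l b]) measurable
qed

text \<open>Substitute \<open>t = u / sqrt g\<close>. In the exponent \<open>a + 1\<close>, the
  \<open>a\<close> comes from the power of \<open>\<bar>t\<bar>\<close> and the \<open>1\<close>
  from the differential.\<close>

lemma integral_Gegenbauer_weight_rescale:
  fixes g a :: real and f :: "real \<Rightarrow> real"
  assumes "g > 0"
  shows "(LBINT t:{-1..1}. f t * \<bar>t\<bar> powr a * (1 - t\<^sup>2) powr (g - 1/2)) =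
     (1 / sqrt g) powr (a + 1) * (LINT u|lborel. indicator {- sqrt g..sqrt g} u *
             (f (u / sqrt g) * \<bar>u\<bar> powr a * (1 - u\<^sup>2 / g) powr (g - 1/2)))"
proof -
  have *: "indicator {-1..1} (u / sqrt g) * (f (u / sqrt g) * \<bar>u / sqrt g\<bar> powr a * (1 - (u / sqrt g)\<^sup>2) powr (g - 1/2))
    = (1 / sqrt g) powr a * (indicator {- sqrt g..sqrt g} u *
             (f (u / sqrt g) * \<bar>u\<bar> powr a * (1 - u\<^sup>2 / g) powr (g - 1/2)))" for u
    using assms by (auto simp: indicator_def abs_divide powr_divide power_divide field_simps)
  have "(LBINT t:{-1..1}. f t * \<bar>t\<bar> powr a * (1 - t\<^sup>2) powr (g - 1/2)) =
     (1 / sqrt g) * (LINT u|lborel. indicator {-1..1} (u / sqrt g) * (f (u / sqrt g) * \<bar>u / sqrt g\<bar> powr a * (1 - (u / sqrt g)\<^sup>2) powr (g - 1/2)))"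
    unfolding set_lebesgue_integral_def
    using assms by (subst lborel_integral_real_affine[where t=0 and c="1 / sqrt g"]) auto
  also have "\<dots> = (1 / sqrt g) * ((1 / sqrt g) powr a * (LINT u|lborel. indicator {- sqrt g..sqrt g} u *
             (f (u / sqrt g) * \<bar>u\<bar> powr a * (1 - u\<^sup>2 / g) powr (g - 1/2))))"
    unfolding * by simp
  finally show ?thesis
    using assms by (simp add: powr_add)
qed

section \<open>Limits and uniform bounds for rescaled Jacobi polynomials\<close>

lemma pochhammer_div_power_tendsto_1:
  "((\<lambda>g::real. pochhammer (g + c) k / g ^ k) \<longlongrightarrow> 1) at_top"
proof -
  have "((\<lambda>g::real. \<Prod>i<k. (g + c + real i) / g) \<longlongrightarrow> (\<Prod>i<k. 1)) at_top"
    by (intro tendsto_prod) real_asymp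
  then show ?thesis
    by (simp add: pochhammer_prod prod_dividef atLeast0LessThan)
qed

lemma gchoose_div_power_tendsto:
  "((\<lambda>g::real. ((g + c) gchoose k) / g ^ k) \<longlongrightarrow> 1 / fact k) at_top"
proof -
  have "((\<lambda>g::real. pochhammer (g + (c - real k + 1)) k / g ^ k / fact k) \<longlongrightarrow> 1 / fact k) at_top"
    by (intro tendsto_divide pochhammer_div_power_tendsto_1) auto
  then show ?thesis
    by (simp add: gbinomial_pochhammer' algebra_simps)
qed

text \<open>The left side divided by \<open>fact j\<close> is one term of the exponential series of
  \<open>\<bar>u\<bar>\<close>, all of whose terms are nonnegative. This lets one exponential
  dominate all the powers of \<open>u\<close> that occur.\<close>

lemma abs_power_le_fact_exp:
  fixes u :: real
  shows "\<bar>u\<bar> ^ j \<le> fact j * exp \<bar>u\<bar>"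
proof -
  have "\<bar>u\<bar> ^ j / fact j \<le> (\<Sum>i\<le>j. \<bar>u\<bar> ^ i / fact i)"
    by (rule member_le_sum) auto
  also have "\<dots> \<le> exp \<bar>u\<bar>"
  proof -
    have "(\<Sum>i\<in>{..j}. \<bar>u\<bar> ^ i /\<^sub>R fact i) \<le> (\<Sum>i. \<bar>u\<bar> ^ i /\<^sub>R fact i)"
      by (rule sum_le_suminf) (use summable_exp_generic[of "\<bar>u\<bar>"] in \<open>auto simp: mult.commute\<close>)
    then show ?thesis by (simp add: exp_def divide_inverse mult.commute)
  qed
  finally show ?thesis by (simp add: field_simps)
qed

text \<open>At \<open>x = 2 * u\<^sup>2 / g - 1\<close> one has
  \<open>(x - 1) / 2 = u\<^sup>2 / g - 1\<close> and \<open>(x + 1) / 2 = u\<^sup>2 / g\<close>. The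
  powers of \<open>g\<close> in the latter are moved under the binomial coefficient, which grows at
  the same rate, so each factor has a finite limit.\<close>

lemma jacobi_poly_rescale:
  fixes g u :: real
  assumes "g > 0"
  shows "jacobi_poly k (g - 1/2) b (2 * (u / sqrt g)\<^sup>2 - 1) =
    (\<Sum>s\<le>k. ((g + (real k - 1/2)) gchoose (k - s)) / g ^ (k - s) * ((real k + b) gchoose s) *
        (u\<^sup>2 / g - 1) ^ s * (u\<^sup>2) ^ (k - s))"
  unfolding jacobi_poly_def
  using assms by (intro sum.cong) (auto simp: power_divide algebra_simps diff_divide_distrib add_divide_distrib)

lemma jacobi_poly_tendsto_laguerre_poly:
  fixes u :: real
  shows "((\<lambda>g. jacobi_poly k (g - 1/2) b (2 * (u / sqrt g)\<^sup>2 - 1)) \<longlongrightarrow> (- 1) ^ k * laguerre_poly k b (u\<^sup>2)) at_top"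
proof -
  have "((\<lambda>g. \<Sum>s\<le>k. ((g + (real k - 1/2)) gchoose (k - s)) / g ^ (k - s) * ((real k + b) gchoose s) *
        (u\<^sup>2 / g - 1) ^ s * (u\<^sup>2) ^ (k - s))
    \<longlongrightarrow> (\<Sum>s\<le>k. 1 / fact (k - s) * ((real k + b) gchoose s) * (- 1) ^ s * (u\<^sup>2) ^ (k - s))) at_top"
    by (intro tendsto_sum tendsto_mult tendsto_power tendsto_const gchoose_div_power_tendsto) real_asymp
  \<comment> \<open>Reversing the summation order puts the power of \<open>u\<^sup>2\<close> at the
    summation index, as in the Laguerre sum; the sign becomes \<open>(- 1) ^ (k - s)\<close>, which
    splits off \<open>(- 1) ^ k\<close>.\<close>
  also have "(\<Sum>s\<le>k. 1 / fact (k - s) * ((real k + b) gchoose s) * (- 1) ^ s * (u\<^sup>2) ^ (k - s))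
     = (\<Sum>s\<le>k. 1 / fact s * ((real k + b) gchoose (k - s)) * (- 1) ^ (k - s) * (u\<^sup>2) ^ s)"
    by (rule sum.reindex_bij_witness[of _ "\<lambda>s. k - s" "\<lambda>s. k - s"]) auto
  also have "\<dots> = (- 1) ^ k * laguerre_poly k b (u\<^sup>2)"
    unfolding laguerre_poly_def sum_distrib_left
    by (intro sum.cong) (auto simp: minus_one_power_iff)
  finally show ?thesis
    by (rule Lim_transform_eventually)
       (auto intro: eventually_mono[OF eventually_gt_at_top[of 0]] simp: jacobi_poly_rescale)
qed

text \<open>Convergent coefficients are eventually bounded, and the remaining powers of
  \<open>u\<close> are absorbed by the exponential. The factor \<open>\<bar>u\<bar> ^ e\<close>
  accommodates the extra \<open>t\<close> of the polynomials of odd degree.\<close>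

lemma jacobi_poly_rescale_bound:
  fixes b :: real
  shows "\<exists>K. eventually (\<lambda>g. \<forall>u. \<bar>u\<bar> \<le> sqrt g \<longrightarrow>
      \<bar>u\<bar> ^ e * \<bar>jacobi_poly k (g - 1/2) b (2 * (u / sqrt g)\<^sup>2 - 1)\<bar> \<le> K * exp \<bar>u\<bar>) at_top"
proof -
  define c where "c = (\<lambda>s g. ((g + (real k - 1/2)) gchoose (k - s)) / g ^ (k - s) * ((real k + b) gchoose s))"
  \<comment> \<open>One more than the limit of \<open>\<bar>c s g\<bar>\<close>, hence an eventual
    strict upper bound; as \<open>s\<close> ranges over a finite set, one threshold for
    \<open>g\<close> serves all terms.\<close>
  define L where "L = (\<lambda>s. \<bar>1 / fact (k - s) * ((real k + b) gchoose s)\<bar> + 1 :: real)"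
  have "eventually (\<lambda>g. \<bar>c s g\<bar> < L s) at_top" for s
  proof (rule order_tendstoD(2))
    show "((\<lambda>g. \<bar>c s g\<bar>) \<longlongrightarrow> \<bar>1 / fact (k - s) * ((real k + b) gchoose s)\<bar>) at_top"
      unfolding c_def by (intro tendsto_rabs tendsto_mult gchoose_div_power_tendsto tendsto_const)
  qed (simp add: L_def)
  then have "eventually (\<lambda>g. \<forall>s\<in>{..k}. \<bar>c s g\<bar> < L s) at_top"
    by (intro eventually_ball_finite) auto
  then have "eventually (\<lambda>g. \<forall>u. \<bar>u\<bar> \<le> sqrt g \<longrightarrow>
      \<bar>u\<bar> ^ e * \<bar>jacobi_poly k (g - 1/2) b (2 * (u / sqrt g)\<^sup>2 - 1)\<bar>
        \<le> (\<Sum>s\<le>k. L s * fact (e + 2 * (k - s))) * exp \<bar>u\<bar>) at_top"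
    using eventually_gt_at_top[of 0]
  proof eventually_elim
    case (elim g)
    show ?case
    proof (intro allI impI)
      fix u :: real
      assume "\<bar>u\<bar> \<le> sqrt g"
      then have u: "u\<^sup>2 \<le> g"
        using elim by (metis abs_ge_zero power2_abs real_le_lsqrt real_sqrt_le_iff real_sqrt_abs)
      have "\<bar>u\<bar> ^ e * \<bar>c s g * (u\<^sup>2 / g - 1) ^ s * (u\<^sup>2) ^ (k - s)\<bar> \<le> L s * fact (e + 2 * (k - s)) * exp \<bar>u\<bar>"
        if "s \<le> k" for s
      proof -
        have "\<bar>u\<^sup>2 / g - 1\<bar> \<le> 1"
          using u elim by (auto simp: abs_le_iff field_simps)
        then have 1: "\<bar>u\<^sup>2 / g - 1\<bar> ^ s \<le> 1"
          by (intro power_le_one) auto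
        have 2: "\<bar>c s g\<bar> \<le> L s"
          using elim that by (auto intro: less_imp_le)
        have 3: "\<bar>u\<bar> ^ e * \<bar>(u\<^sup>2) ^ (k - s)\<bar> \<le> fact (e + 2 * (k - s)) * exp \<bar>u\<bar>"
          using abs_power_le_fact_exp[of u "e + 2 * (k - s)"] by (simp add: power_add power_mult)
        have "\<bar>u\<bar> ^ e * \<bar>c s g * (u\<^sup>2 / g - 1) ^ s * (u\<^sup>2) ^ (k - s)\<bar>
            = \<bar>c s g\<bar> * \<bar>u\<^sup>2 / g - 1\<bar> ^ s * (\<bar>u\<bar> ^ e * \<bar>(u\<^sup>2) ^ (k - s)\<bar>)"
          by (simp add: abs_mult power_abs mult_ac)
        also have "\<dots> \<le> L s * 1 * (fact (e + 2 * (k - s)) * exp \<bar>u\<bar>)"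
          by (intro mult_mono 1 2 3) (auto simp: L_def)
        finally show ?thesis by (simp add: mult.assoc)
      qed
      then have "(\<Sum>s\<le>k. \<bar>u\<bar> ^ e * \<bar>c s g * (u\<^sup>2 / g - 1) ^ s * (u\<^sup>2) ^ (k - s)\<bar>)
          \<le> (\<Sum>s\<le>k. L s * fact (e + 2 * (k - s)) * exp \<bar>u\<bar>)"
        by (intro sum_mono) auto
      moreover have "\<bar>u\<bar> ^ e * \<bar>jacobi_poly k (g - 1/2) b (2 * (u / sqrt g)\<^sup>2 - 1)\<bar>
          \<le> (\<Sum>s\<le>k. \<bar>u\<bar> ^ e * \<bar>c s g * (u\<^sup>2 / g - 1) ^ s * (u\<^sup>2) ^ (k - s)\<bar>)"
        unfolding jacobi_poly_rescale[OF elim(2)] sum_distrib_left[symmetric] c_def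
        by (intro mult_left_mono sum_abs) auto
      ultimately show "\<bar>u\<bar> ^ e * \<bar>jacobi_poly k (g - 1/2) b (2 * (u / sqrt g)\<^sup>2 - 1)\<bar>
          \<le> (\<Sum>s\<le>k. L s * fact (e + 2 * (k - s))) * exp \<bar>u\<bar>"
        by (simp add: sum_distrib_right)
    qed
  qed
  then show ?thesis by blast
qed

section \<open>From generalized Gegenbauer to generalized Hermite polynomials\<close>

lemma gen_gegenbauer_rescale:
  fixes g u mu :: real
  assumes "g > 0"
  shows "gen_gegenbauer g mu N (u / sqrt g) / sqrt g ^ N =
    pochhammer (g + mu) ((N + 1) div 2) / g ^ ((N + 1) div 2) / pochhammer (mu + 1/2) ((N + 1) div 2) *
      (u ^ (N mod 2) * jacobi_poly (N div 2) (g - 1/2) (mu - 1/2 + real (N mod 2)) (2 * (u / sqrt g)\<^sup>2 - 1))"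
proof (cases "even N")
  case True
  then obtain k where N: "N = 2 * k" by blast
  show ?thesis
    using assms by (simp add: N gen_gegenbauer_def power_mult)
next
  case False
  then obtain k where N: "N = 2 * k + 1" using oddE by blast
  \<comment> \<open>In odd degree the factor \<open>u / sqrt g\<close> supplies one more
    \<open>sqrt g\<close> in the denominator. This completes the power \<open>g ^ (k + 1)\<close>
    that balances a Pochhammer symbol of length \<open>k + 1\<close>, so
    \<open>(N + 1) div 2\<close> is the right exponent for both parities.\<close>
  have r: "sqrt g * sqrt g ^ (2 * k + 1) = g ^ (k + 1)"
  proof -
    have "sqrt g * sqrt g ^ (2 * k + 1) = sqrt g ^ (2 * (k + 1))"
      by simp
    also have "\<dots> = ((sqrt g)\<^sup>2) ^ (k + 1)"
      by (simp only: power_mult)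
    finally show ?thesis using assms by simp
  qed
  have "A / p * (u / sqrt g) * J / sqrt g ^ (2 * k + 1) = A / g ^ (k + 1) / p * (u * J)" for A p J
    unfolding r[symmetric] by (simp only: times_divide_eq_left times_divide_eq_right divide_divide_eq_left mult_ac)
  moreover have "(2 * k + 1 + 1) div 2 = k + 1" "(2 * k + 1) div 2 = k" "(2 * k + 1) mod 2 = 1"
    "mu - 1/2 + real 1 = mu + 1/2" "odd (2 * k + 1)" "u ^ 1 = u"
    by auto
  ultimately show ?thesis
    unfolding N gen_gegenbauer_def Let_def by (simp only: if_False)
qed

text \<open>The ratio of the limiting Gegenbauer polynomial to the Hermite polynomial. The sign
  \<open>(- 1) ^ (N div 2)\<close> occurs in both and cancels, so the constant is positive for
  \<open>mu > - 1/2\<close>; it drops out after normalization.\<close>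

definition gegenbauer_hermite_const :: "real \<Rightarrow> nat \<Rightarrow> real" where
  "gegenbauer_hermite_const mu N = 1 / (2 ^ N * fact (N div 2) * pochhammer (mu + 1/2) ((N + 1) div 2))"

lemma gen_hermite_eq_laguerre_poly:
  "gen_hermite mu N u =
    (- 1) ^ (N div 2) * 2 ^ N * fact (N div 2) * u ^ (N mod 2) * laguerre_poly (N div 2) (mu - 1/2 + real (N mod 2)) (u\<^sup>2)"
  unfolding gen_hermite_def Let_def
  by (cases "even N") (auto elim!: evenE oddE simp: add.commute)

lemma gen_gegenbauer_tendsto_gen_hermite:
  assumes "mu > - 1/2"
  shows "((\<lambda>g. gen_gegenbauer g mu N (u / sqrt g) / sqrt g ^ N)
      \<longlongrightarrow> gegenbauer_hermite_const mu N * gen_hermite mu N u) at_top"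
proof -
  have "((\<lambda>g. pochhammer (g + mu) ((N + 1) div 2) / g ^ ((N + 1) div 2) / pochhammer (mu + 1/2) ((N + 1) div 2) *
      (u ^ (N mod 2) * jacobi_poly (N div 2) (g - 1/2) (mu - 1/2 + real (N mod 2)) (2 * (u / sqrt g)\<^sup>2 - 1)))
    \<longlongrightarrow> 1 / pochhammer (mu + 1/2) ((N + 1) div 2) *
      (u ^ (N mod 2) * ((- 1) ^ (N div 2) * laguerre_poly (N div 2) (mu - 1/2 + real (N mod 2)) (u\<^sup>2)))) at_top"
    using assms pochhammer_pos[of "mu + 1/2"]
    by (intro tendsto_mult tendsto_divide tendsto_const pochhammer_div_power_tendsto_1
        jacobi_poly_tendsto_laguerre_poly) (auto simp: less_imp_neq[symmetric])
  also have "1 / pochhammer (mu + 1/2) ((N + 1) div 2) *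
      (u ^ (N mod 2) * ((- 1) ^ (N div 2) * laguerre_poly (N div 2) (mu - 1/2 + real (N mod 2)) (u\<^sup>2)))
     = gegenbauer_hermite_const mu N * gen_hermite mu N u"
    by (simp add: gegenbauer_hermite_const_def gen_hermite_eq_laguerre_poly)
  finally show ?thesis
    by (rule Lim_transform_eventually)
       (auto intro: eventually_mono[OF eventually_gt_at_top[of 0]] simp: gen_gegenbauer_rescale)
qed

lemma gen_gegenbauer_rescale_bound:
  assumes "mu > - 1/2"
  shows "\<exists>K. eventually (\<lambda>g. \<forall>u. \<bar>u\<bar> \<le> sqrt g \<longrightarrow>
      \<bar>gen_gegenbauer g mu N (u / sqrt g) / sqrt g ^ N\<bar> \<le> K * exp \<bar>u\<bar>) at_top"
proof -
  define p where "p = pochhammer (mu + 1/2) ((N + 1) div 2)"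
  have p: "p > 0" unfolding p_def using assms by (intro pochhammer_pos) auto
  obtain K where K: "eventually (\<lambda>g. \<forall>u. \<bar>u\<bar> \<le> sqrt g \<longrightarrow>
      \<bar>u\<bar> ^ (N mod 2) * \<bar>jacobi_poly (N div 2) (g - 1/2) (mu - 1/2 + real (N mod 2)) (2 * (u / sqrt g)\<^sup>2 - 1)\<bar> \<le> K * exp \<bar>u\<bar>) at_top"
    using jacobi_poly_rescale_bound by blast
  \<comment> \<open>The quotient tends to \<open>1\<close>; any bound above \<open>1\<close> would
    do in place of \<open>2\<close>.\<close>
  have "eventually (\<lambda>g. \<bar>pochhammer (g + mu) ((N + 1) div 2) / g ^ ((N + 1) div 2)\<bar> < 2) at_top"
    by (rule order_tendstoD(2)[OF tendsto_rabs[OF pochhammer_div_power_tendsto_1]]) simp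
  then have "eventually (\<lambda>g. \<forall>u. \<bar>u\<bar> \<le> sqrt g \<longrightarrow>
      \<bar>gen_gegenbauer g mu N (u / sqrt g) / sqrt g ^ N\<bar> \<le> (2 / p * K) * exp \<bar>u\<bar>) at_top"
    using K eventually_gt_at_top[of 0]
  proof eventually_elim
    case (elim g)
    show ?case
    proof (intro allI impI)
      fix u :: real
      assume u: "\<bar>u\<bar> \<le> sqrt g"
      have "\<bar>gen_gegenbauer g mu N (u / sqrt g) / sqrt g ^ N\<bar> =
          \<bar>pochhammer (g + mu) ((N + 1) div 2) / g ^ ((N + 1) div 2)\<bar> / p *
          (\<bar>u\<bar> ^ (N mod 2) * \<bar>jacobi_poly (N div 2) (g - 1/2) (mu - 1/2 + real (N mod 2)) (2 * (u / sqrt g)\<^sup>2 - 1)\<bar>)"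
        unfolding gen_gegenbauer_rescale[OF elim(3)] p_def[symmetric]
        using p by (simp add: abs_mult power_abs)
      also have "\<dots> \<le> 2 / p * (K * exp \<bar>u\<bar>)"
        using elim u p by (intro mult_mono[where c = "_ ^ _ * _"] divide_right_mono) auto
      finally show "\<bar>gen_gegenbauer g mu N (u / sqrt g) / sqrt g ^ N\<bar> \<le> (2 / p * K) * exp \<bar>u\<bar>"
        by simp
    qed
  qed
  then show ?thesis by blast
qed

lemma measurable_gen_gegenbauer [measurable]:
  "gen_gegenbauer g mu N \<in> borel_measurable borel"
  unfolding gen_gegenbauer_def jacobi_poly_def Let_def
  by (cases "even N") simp_all

section \<open>Positivity of the limiting norm integrals\<close>

lemma finite_roots_gen_hermite: "finite {u. gen_hermite mu N u = 0}"
proof -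
  define k where "k = N div 2"
  define a where "a = mu - 1/2 + real (N mod 2)"
  define S where "S = {x. (\<Sum>j\<le>k. ((- 1) ^ j * ((real k + a) gchoose (k - j)) / fact j) * x ^ j) = 0}"
  have "finite S"
    \<comment> \<open>The leading coefficient is \<open>(- 1) ^ k / fact k\<close>, since
      \<open>gchoose 0\<close> is \<open>1\<close>; hence it is nonzero for every
      \<open>a\<close>.\<close>
    unfolding S_def polyfun_finite_roots by (intro exI[of _ k]) simp
  have "{u. gen_hermite mu N u = 0} \<subseteq> insert 0 (sqrt ` S \<union> (\<lambda>x. - sqrt x) ` S)"
  proof
    fix u assume "u \<in> {u. gen_hermite mu N u = 0}"
    then have "u = 0 \<or> laguerre_poly k a (u\<^sup>2) = 0"
      by (auto simp: gen_hermite_eq_laguerre_poly k_def a_def)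
    moreover have "laguerre_poly k a (u\<^sup>2) = 0 \<Longrightarrow> u\<^sup>2 \<in> S"
      by (simp add: laguerre_poly_def S_def)
    moreover have "u = sqrt (u\<^sup>2) \<or> u = - sqrt (u\<^sup>2)"
      by auto
    ultimately show "u \<in> insert 0 (sqrt ` S \<union> (\<lambda>x. - sqrt x) ` S)"
      by blast
  qed
  then show ?thesis
    using \<open>finite S\<close> by (auto intro: finite_subset)
qed

lemma integral_square_powr_gaussian_pos:
  fixes H :: "real \<Rightarrow> real"
  assumes int: "integrable lborel (\<lambda>u. (H u)\<^sup>2 * \<bar>u\<bar> powr a * exp (- u\<^sup>2))"
    and fin: "finite {u. H u = 0}"
  shows "(LINT u|lborel. (H u)\<^sup>2 * \<bar>u\<bar> powr a * exp (- u\<^sup>2)) > 0"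
proof -
  let ?f = "\<lambda>u. (H u)\<^sup>2 * \<bar>u\<bar> powr a * exp (- u\<^sup>2)"
  have "(LINT u|lborel. ?f u) \<noteq> 0"
  proof
    assume "(LINT u|lborel. ?f u) = 0"
    then have "AE u in lborel. ?f u = 0"
      using integral_nonneg_eq_0_iff_AE[OF int] by simp
    \<comment> \<open>The point \<open>0\<close> is adjoined because \<open>0 powr a = 0\<close>
      makes the integrand vanish there whatever the value of \<open>H\<close>.\<close>
    then have "AE u in lborel. u \<in> insert 0 {u. H u = 0}"
      by (rule eventually_mono) auto
    moreover have "AE u in lborel. u \<notin> insert (0::real) {u. H u = 0}"
      using fin by (intro AE_not_in finite_imp_null_set_lborel) auto
    ultimately have "AE u in (lborel :: real measure). False"
      by eventually_elim blast
    then show False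
      by (simp add: eventually_False ae_filter_eq_bot_iff)
  qed
  moreover have "(LINT u|lborel. ?f u) \<ge> 0"
    by (rule Bochner_Integration.integral_nonneg) auto
  ultimately show ?thesis by linarith
qed

section \<open>Integration over the sphere and reduction to one variable\<close>

lemma homogeneous_poly_scale:
  assumes "homogeneous_poly m f"
  shows "f (c *\<^sub>R x) = c ^ m * f x"
proof -
  obtain C where f: "f = (\<lambda>x. \<Sum>\<alpha> | (\<Sum>i\<in>UNIV. \<alpha> i) = m. C \<alpha> * (\<Prod>i\<in>UNIV. (x $ i) ^ \<alpha> i))"
    using assms unfolding homogeneous_poly_def by blast
  show ?thesis
    unfolding f sum_distrib_left
    by (intro sum.cong) (auto simp: power_mult_distrib prod.distrib power_sum mult_ac)
qed

lemma prob_space_sphere_measure: "prob_space (sphere_measure :: (real ^ 'd) measure)"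
  unfolding sphere_measure_def
proof (rule prob_space.prob_space_distr)
  have "emeasure lborel (ball 0 1 :: (real ^ 'd) set) \<noteq> 0"
    using content_ball_pos[of 1 "0 :: real ^ 'd"] by (auto simp: measure_def)
  moreover have "emeasure lborel (ball 0 1 :: (real ^ 'd) set) \<noteq> \<infinity>"
    using emeasure_lborel_ball_finite[of "0 :: real ^ 'd" 1] by (metis infinity_ennreal_def order_less_irrefl)
  ultimately show "prob_space (uniform_measure lborel (ball 0 1 :: (real ^ 'd) set))"
    by (rule prob_space_uniform_measure)
qed simp

text \<open>Homogeneity pulls \<open>r ^ m\<close> out of each factor and leaves the normalized
  integral. In the cone forms \<open>r\<close> is \<open>\<bar>t\<bar>\<close> and \<open>a\<close>
  is the value of the one-variable polynomial at \<open>t\<close>.\<close>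

lemma sphere_integral_square_homogeneous:
  assumes "homogeneous_poly m f" and "(LINT \<xi>|sphere_measure. f \<xi> * f \<xi>) = 1"
  shows "(LINT \<xi>|sphere_measure. (a * f (r *\<^sub>R \<xi>)) * (a * f (r *\<^sub>R \<xi>))) = a\<^sup>2 * r ^ (2 * m)"
proof -
  have "r ^ (2 * m) = r ^ m * r ^ m"
    by (simp add: mult_2 power_add)
  then have "(LINT \<xi>|sphere_measure. (a * f (r *\<^sub>R \<xi>)) * (a * f (r *\<^sub>R \<xi>)))
      = (LINT \<xi>|sphere_measure. (a\<^sup>2 * r ^ (2 * m)) * (f \<xi> * f \<xi>))"
    unfolding homogeneous_poly_scale[OF assms(1)]
    by (simp only: power2_eq_square mult_ac)
  then show ?thesis using assms(2) by simp
qed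

text \<open>At \<open>t = 0\<close> both sides vanish because \<open>0 powr b = 0\<close>, even when
  \<open>j\<close> and \<open>k\<close> are \<open>0\<close>; elsewhere this is the addition law for
  exponents.\<close>

lemma abs_powr_collect:
  fixes t :: real
  shows "\<bar>t\<bar> ^ j * (A * \<bar>t\<bar> ^ k) * \<bar>t\<bar> powr b = A * \<bar>t\<bar> powr (real k + real j + b)"
  by (cases "t = 0") (auto simp: powr_add powr_realpow)

lemma harmonic_onb_D:
  fixes Y :: "nat \<Rightarrow> real ^ 'd \<Rightarrow> real"
  assumes "harmonic_onb m Y" and "1 \<le> l"
    and "l \<le> fun_vs.dim (harmonic_space m :: (real ^ 'd \<Rightarrow> real) set)"
  shows "homogeneous_poly m (Y l)" and "(LINT \<xi>|sphere_measure. Y l \<xi> * Y l \<xi>) = 1"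
proof -
  let ?I = "{1..fun_vs.dim (harmonic_space m :: (real ^ 'd \<Rightarrow> real) set)}"
  have l: "l \<in> ?I" using assms by simp
  have "Y l \<in> fun_vs.span (Y ` ?I)"
    using l by (intro fun_vs.span_base) blast
  then show "homogeneous_poly m (Y l)"
    using assms(1) by (auto simp: harmonic_onb_def Let_def harmonic_space_def)
  show "(LINT \<xi>|sphere_measure. Y l \<xi> * Y l \<xi>) = 1"
    using assms(1) l by (auto simp: harmonic_onb_def Let_def)
qed

text \<open>The redundant-looking \<open>1 *\<close> and \<open>1\<^sup>2\<close> give the integrals
  the shape of the rescaling and convergence lemmas, with the constant function \<open>1\<close> as
  the polynomial.\<close>

lemma cone_form_1:
  fixes \<beta> \<gamma> :: real
  defines "a \<equiv> 2 * \<beta> + real (CARD('d) - 1)"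
  shows "cone_form_C \<beta> \<gamma> (\<lambda>_ :: (real ^ 'd) \<times> real. 1) (\<lambda>_. 1) =
      (LBINT t:{-1..1}. 1 * \<bar>t\<bar> powr a * (1 - t\<^sup>2) powr (\<gamma> - 1/2))" (is ?C)
    and "cone_form_H \<beta> (\<lambda>_ :: (real ^ 'd) \<times> real. 1) (\<lambda>_. 1) =
      (LINT t|lborel. 1\<^sup>2 * \<bar>t\<bar> powr a * exp (- t\<^sup>2))" (is ?H)
proof -
  interpret prob_space "sphere_measure :: (real ^ 'd) measure"
    by (rule prob_space_sphere_measure)
  have *: "\<bar>t\<bar> ^ (CARD('d) - 1) * \<bar>t\<bar> powr (2 * \<beta>) = \<bar>t\<bar> powr a" for t :: real
    using abs_powr_collect[of t "CARD('d) - 1" 1 0 "2 * \<beta>"] by (simp add: a_def add_ac)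
  show ?C ?H
    unfolding cone_form_C_def cone_form_H_def by (simp_all add: prob_space * del: One_nat_def)
qed

text \<open>The exponent \<open>a\<close> collects \<open>2 * \<beta>\<close> from the weight, the
  dimension minus one from the surface factor, and \<open>2 * m\<close> from the two copies of the
  homogeneous \<open>Y m l\<close>.\<close>

lemma cone_form_square:
  fixes Y :: "nat \<Rightarrow> nat \<Rightarrow> real ^ 'd \<Rightarrow> real" and \<beta> \<gamma> :: real
  assumes "homogeneous_poly m (Y m l)" and "(LINT \<xi>|sphere_measure. Y m l \<xi> * Y m l \<xi>) = 1"
  defines "a \<equiv> 2 * \<beta> + real (CARD('d) - 1) + real (2 * m)"
    and "mu \<equiv> real m + \<beta> + (real CARD('d) - 1) / 2"
  shows "cone_form_C \<beta> \<gamma> (cone_C Y \<beta> \<gamma> m l n) (cone_C Y \<beta> \<gamma> m l n) =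
      (LBINT t:{-1..1}. (gen_gegenbauer \<gamma> mu (n - m) t)\<^sup>2 * \<bar>t\<bar> powr a * (1 - t\<^sup>2) powr (\<gamma> - 1/2))" (is ?C)
    and "cone_form_H \<beta> (cone_H Y \<beta> m l n) (cone_H Y \<beta> m l n) =
      (LINT t|lborel. (gen_hermite mu (n - m) t)\<^sup>2 * \<bar>t\<bar> powr a * exp (- t\<^sup>2))" (is ?H)
proof -
  have *: "\<bar>t\<bar> ^ (CARD('d) - 1) * (A * \<bar>t\<bar> ^ (2 * m)) * \<bar>t\<bar> powr (2 * \<beta>) = A * \<bar>t\<bar> powr a" for t A :: real
    unfolding abs_powr_collect by (simp add: a_def add_ac)
  show ?C ?H
    unfolding cone_form_C_def cone_form_H_def cone_C_def cone_H_def prod.case mu_def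
      sphere_integral_square_homogeneous[OF assms(1,2)] * by (rule refl)+
qed

section \<open>Passage to the limit on the double cone\<close>

theorem theorem7p2:
  fixes Y :: "nat \<Rightarrow> nat \<Rightarrow> real ^ 'd \<Rightarrow> real"
    and \<beta> t :: real and m n l :: nat and x :: "real ^ 'd"
  assumes "CARD('d) \<ge> 2"
    and "\<beta> > - real CARD('d) / 2"
    and "m \<le> n"
    and "harmonic_onb m (Y m)"
    and "1 \<le> l" and "l \<le> fun_vs.dim (harmonic_space m :: (real ^ 'd \<Rightarrow> real) set)"
    and "norm x = \<bar>t\<bar>"
  shows "((\<lambda>\<gamma>. cone_C Y \<beta> \<gamma> m l n (x /\<^sub>R sqrt \<gamma>, t / sqrt \<gamma>) / sqrt (norm_sq_C Y \<beta> \<gamma> m l n))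
           \<longlongrightarrow> cone_H Y \<beta> m l n (x, t) / sqrt (norm_sq_H Y \<beta> m l n)) at_top"
proof -
  define N where "N = n - m"
  define mu where "mu = real m + \<beta> + (real CARD('d) - 1) / 2"
  define a0 where "a0 = 2 * \<beta> + real (CARD('d) - 1)"
  define a where "a = a0 + real (2 * m)"
  have "mu > - 1/2"
    using assms(2) by (simp add: mu_def field_simps)
  have a0: "a0 > -1" and a: "a > -1"
    using assms(1,2) by (auto simp: a_def a0_def of_nat_diff)
  define \<kappa> where "\<kappa> = gegenbauer_hermite_const mu N"
  have \<kappa>: "\<kappa> > 0"
    unfolding \<kappa>_def gegenbauer_hermite_const_def using \<open>mu > - 1/2\<close> by (simp add: pochhammer_pos)
  note Y = harmonic_onb_D[OF assms(4-6)]
  define F where "F = (\<lambda>\<gamma> u. gen_gegenbauer \<gamma> mu N (u / sqrt \<gamma>) / sqrt \<gamma> ^ N)"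
  \<comment> \<open>Both integrals in a Gegenbauer norm have this form after rescaling:
    \<open>F\<close> with exponent \<open>a\<close> for the polynomial, and the constant
    \<open>1\<close> with exponent \<open>a0\<close> for the normalizing constant.\<close>
  define w where "w = (\<lambda>f b \<gamma>. LINT u|lborel. indicator {- sqrt \<gamma>..sqrt \<gamma>} u *
             ((f \<gamma> u)\<^sup>2 * \<bar>u\<bar> powr b * (1 - u\<^sup>2 / \<gamma>) powr (\<gamma> - 1/2)) :: real)"
  define I where "I = (LINT u|lborel. (gen_hermite mu N u)\<^sup>2 * \<bar>u\<bar> powr a * exp (- u\<^sup>2))"
  define I0 where "I0 = (LINT u|lborel. 1\<^sup>2 * \<bar>u::real\<bar> powr a0 * exp (- u\<^sup>2))"
  have limF: "((\<lambda>\<gamma>. F \<gamma> u) \<longlongrightarrow> \<kappa> * gen_hermite mu N u) at_top" for u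
    unfolding F_def \<kappa>_def using \<open>mu > - 1/2\<close> by (rule gen_gegenbauer_tendsto_gen_hermite)
  have measF: "F \<gamma> \<in> borel_measurable borel" for \<gamma>
    unfolding F_def by measurable
  obtain K where K: "eventually (\<lambda>\<gamma>. \<forall>u. \<bar>u\<bar> \<le> sqrt \<gamma> \<longrightarrow> \<bar>F \<gamma> u\<bar> \<le> K * exp \<bar>u\<bar>) at_top"
    unfolding F_def using gen_gegenbauer_rescale_bound[OF \<open>mu > - 1/2\<close>] by blast
  have "(LINT u|lborel. (\<kappa> * gen_hermite mu N u)\<^sup>2 * \<bar>u\<bar> powr a * exp (- u\<^sup>2)) = \<kappa>\<^sup>2 * I"
    unfolding I_def by (simp add: power_mult_distrib mult.assoc)
  \<comment> \<open>Integrability comes from dominated convergence for the scaled limit, so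
    positivity is shown with the factor \<open>\<kappa>\<close> present; dividing by
    \<open>\<kappa>\<^sup>2\<close> then yields \<open>I > 0\<close>.\<close>
  moreover have "0 < (LINT u|lborel. (\<kappa> * gen_hermite mu N u)\<^sup>2 * \<bar>u\<bar> powr a * exp (- u\<^sup>2))"
    using powr_weight_integral_tendsto(2)[OF a measF limF K] \<kappa>
    by (intro integral_square_powr_gaussian_pos) (auto simp: finite_roots_gen_hermite)
  ultimately have "I > 0" and limI: "(w F a \<longlongrightarrow> \<kappa>\<^sup>2 * I) at_top"
    using powr_weight_integral_tendsto(1)[OF a measF limF K] \<kappa> unfolding w_def
    by (auto simp: zero_less_mult_iff)
  have K1: "eventually (\<lambda>\<gamma>. \<forall>u. \<bar>u\<bar> \<le> sqrt \<gamma> \<longrightarrow> \<bar>1::real\<bar> \<le> 1 * exp \<bar>u\<bar>) at_top"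
    by auto
  have "I0 > 0"
    unfolding I0_def
    using powr_weight_integral_tendsto(2)[OF a0 _ tendsto_const K1]
    by (intro integral_square_powr_gaussian_pos) auto
  have limI0: "(w (\<lambda>_ _. 1) a0 \<longlongrightarrow> I0) at_top"
    unfolding w_def I0_def
    by (rule powr_weight_integral_tendsto(1)[OF a0 _ tendsto_const K1]) auto
  \<comment> \<open>The factor \<open>(1 / sqrt \<gamma>) powr (a0 + 1)\<close> is common to both
    integrals and cancels. What remains is \<open>(sqrt \<gamma> ^ N)\<^sup>2\<close> from the
    definition of \<open>F\<close> and \<open>(1 / sqrt \<gamma> ^ m)\<^sup>2\<close> from
    \<open>a - a0 = 2 * m\<close>.\<close>
  have normC: "norm_sq_C Y \<beta> \<gamma> m l n = (sqrt \<gamma> ^ N / sqrt \<gamma> ^ m)\<^sup>2 * (w F a \<gamma> / w (\<lambda>_ _. 1) a0 \<gamma>)"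
    if "\<gamma> > 0" for \<gamma>
  proof -
    have [simp]: "(gen_gegenbauer \<gamma> mu N (u / sqrt \<gamma>))\<^sup>2 = (sqrt \<gamma> ^ N)\<^sup>2 * (F \<gamma> u)\<^sup>2" for u
      using that by (simp add: F_def power_divide)
    have "cone_form_C \<beta> \<gamma> (cone_C Y \<beta> \<gamma> m l n) (cone_C Y \<beta> \<gamma> m l n)
        = (1 / sqrt \<gamma>) powr (a + 1) * ((sqrt \<gamma> ^ N)\<^sup>2 * w F a \<gamma>)"
      unfolding cone_form_square[of m Y l, OF Y] mu_def[symmetric] N_def[symmetric] a0_def[symmetric] a_def[symmetric]
        integral_Gegenbauer_weight_rescale[OF that] w_def
      by (simp add: mult.assoc mult.left_commute[of _ "(sqrt \<gamma> ^ N)\<^sup>2"])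
    moreover have "cone_form_C \<beta> \<gamma> (\<lambda>_ :: (real ^ 'd) \<times> real. 1) (\<lambda>_. 1)
        = (1 / sqrt \<gamma>) powr (a0 + 1) * w (\<lambda>_ _. 1) a0 \<gamma>"
      unfolding cone_form_1 a0_def[symmetric] integral_Gegenbauer_weight_rescale[OF that] w_def by simp
    moreover have "(1 / sqrt \<gamma>) powr (a + 1) = (1 / sqrt \<gamma>) powr (a0 + 1) * (1 / sqrt \<gamma> ^ m)\<^sup>2"
    proof -
      have "(1 / sqrt \<gamma>) powr (a + 1) = (1 / sqrt \<gamma>) powr (a0 + 1) * (1 / sqrt \<gamma>) powr real (2 * m)"
        by (simp add: a_def flip: powr_add) (simp add: add_ac)
      also have "(1 / sqrt \<gamma>) powr real (2 * m) = (1 / sqrt \<gamma> ^ m)\<^sup>2"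
        using that by (subst powr_realpow) (auto simp: power_divide power_mult mult.commute[of 2])
      finally show ?thesis .
    qed
    ultimately show ?thesis
      using that by (simp add: norm_sq_C_def cone_inner_C_def power_divide)
  qed
  have normH: "norm_sq_H Y \<beta> m l n = I / I0"
    unfolding norm_sq_H_def cone_inner_H_def cone_form_square[of m Y l, OF Y] cone_form_1
      mu_def[symmetric] N_def[symmetric] a0_def[symmetric] a_def[symmetric] I_def I0_def by simp
  \<comment> \<open>The numerator carries the same factor
    \<open>sqrt \<gamma> ^ N / sqrt \<gamma> ^ m\<close> as the root of the norm, its denominator
    coming from the homogeneity of \<open>Y m l\<close>.\<close>
  have ev: "eventually (\<lambda>\<gamma>. F \<gamma> t * Y m l x / sqrt (w F a \<gamma> / w (\<lambda>_ _. 1) a0 \<gamma>) =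
      cone_C Y \<beta> \<gamma> m l n (x /\<^sub>R sqrt \<gamma>, t / sqrt \<gamma>) / sqrt (norm_sq_C Y \<beta> \<gamma> m l n)) at_top"
    using eventually_gt_at_top[of 0]
  proof eventually_elim
    case (elim \<gamma>)
    have "cone_C Y \<beta> \<gamma> m l n (x /\<^sub>R sqrt \<gamma>, t / sqrt \<gamma>) = sqrt \<gamma> ^ N / sqrt \<gamma> ^ m * (F \<gamma> t * Y m l x)"
      using elim unfolding cone_C_def prod.case homogeneous_poly_scale[OF Y(1)] mu_def[symmetric] N_def[symmetric] F_def
      by (simp add: field_simps power_inverse)
    moreover have "sqrt (norm_sq_C Y \<beta> \<gamma> m l n)
        = sqrt \<gamma> ^ N / sqrt \<gamma> ^ m * sqrt (w F a \<gamma> / w (\<lambda>_ _. 1) a0 \<gamma>)"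
      unfolding normC[OF elim] real_sqrt_mult using elim by simp
    ultimately show ?case
      using elim by simp
  qed
  have lim: "((\<lambda>\<gamma>. F \<gamma> t * Y m l x / sqrt (w F a \<gamma> / w (\<lambda>_ _. 1) a0 \<gamma>))
      \<longlongrightarrow> \<kappa> * gen_hermite mu N t * Y m l x / sqrt (\<kappa>\<^sup>2 * I / I0)) at_top"
    using \<kappa> \<open>I > 0\<close> \<open>I0 > 0\<close>
    by (intro tendsto_divide tendsto_mult tendsto_real_sqrt limF limI limI0 tendsto_const) auto
  \<comment> \<open>Since \<open>\<kappa>\<close> is positive,
    \<open>sqrt (\<kappa>\<^sup>2) = \<kappa>\<close> and the constant cancels with the correct
    sign.\<close>
  have eq: "\<kappa> * gen_hermite mu N t * Y m l x / sqrt (\<kappa>\<^sup>2 * I / I0)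
      = cone_H Y \<beta> m l n (x, t) / sqrt (norm_sq_H Y \<beta> m l n)"
    using \<kappa> unfolding normH
    by (simp add: cone_H_def mu_def[symmetric] N_def[symmetric] real_sqrt_mult real_sqrt_divide)
  show ?thesis
    using Lim_transform_eventually[OF lim ev] unfolding eq .
qed

end
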